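(* Let $S$ be a semiring. Then the following statements are equivalent: (1) $S$ is a weak Gaussian semiring; (2) $\sqrt{I}$ is subtractive for each ideal $I$ of $S$; (3) each prime ideal $\mathbf{p}$ of $S$ is subtractive.
   Context: A semiring $(S,+,\cdot,0,1)$ is commutative: $(S,+,0)$ and $(S,\cdot,1)$ are commutative monoids, $1\neq 0$, multiplication distributes over addition, and $s\cdot 0=0$ for all $s$. An ideal is a nonempty subset closed under addition and under multiplication by elements of $S$. A prime ideal is an ideal $P\neq S$ such that $ab\in P$ implies $a\in P$ or $b\in P$. An ideal $I$ is subtractive if for all $a,b\in S$, $a+b\in I$ and $a\in I$ imply $b\in I$. The radical is $\sqrt{I}=\{s\in S: s^n\in I \text{ for some } n\in\mathbb{N}\}$ with $\mathbb N$ the positive integers. For $f\in S[X]$, $c(f)$ is the ideal of $S$ generated by the coefficients of $f$. The product $IJ$ of ideals is the set of finite sums of products $ab$ with $a\in I$, $b\in J$. $S$ is weak Gaussian if $c(f)c(g)\subseteq\sqrt{c(fg)}$ for all $f,g\in S[X]$. *)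

theory Defs
  imports "HOL-Computational_Algebra.Polynomial"
begin

text \<open>
  The class \<^class>\<open>comm_semiring_1\<close> is exactly a commutative semiring with \<open>1 \<noteq> 0\<close> and
  absorbing \<open>0\<close>; the semiring \<open>S\<close> is the whole type.
\<close>

definition semiring_ideal :: "'a::comm_semiring_1 set \<Rightarrow> bool" where
  "semiring_ideal I \<longleftrightarrow>
     I \<noteq> {} \<and> (\<forall>a\<in>I. \<forall>b\<in>I. a + b \<in> I) \<and> (\<forall>s. \<forall>a\<in>I. s * a \<in> I)"

definition prime_semiring_ideal :: "'a::comm_semiring_1 set \<Rightarrow> bool" where
  "prime_semiring_ideal P \<longleftrightarrow>
     semiring_ideal P \<and> P \<noteq> UNIV \<and> (\<forall>a b. a * b \<in> P \<longrightarrow> a \<in> P \<or> b \<in> P)"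

text \<open>Meaningful for ideals only; being an ideal is not part of the predicate.\<close>

definition subtractive :: "'a::comm_semiring_1 set \<Rightarrow> bool" where
  "subtractive I \<longleftrightarrow> (\<forall>a b. a + b \<in> I \<longrightarrow> a \<in> I \<longrightarrow> b \<in> I)"

definition radical :: "'a::comm_semiring_1 set \<Rightarrow> 'a set" where
  "radical I = {s. \<exists>n>0. s ^ n \<in> I}"

definition ideal_prod :: "'a::comm_semiring_1 set \<Rightarrow> 'a set \<Rightarrow> 'a set" where
  "ideal_prod I J =
     {\<Sum>i<n. a i * b i | (n::nat) a b. \<forall>i<n. a i \<in> I \<and> b i \<in> J}"

definition content_ideal :: "'a::comm_semiring_1 poly \<Rightarrow> 'a set" where
  "content_ideal f = semiring_ideal hull (range (coeff f))"

definition weak_Gaussian :: "'a::comm_semiring_1 itself \<Rightarrow> bool" where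
  "weak_Gaussian _ \<longleftrightarrow>
     (\<forall>f g :: 'a poly.
        ideal_prod (content_ideal f) (content_ideal g) \<subseteq> radical (content_ideal (f * g)))"

end

theory Submission
  imports Defs
begin

text \<open>
  Everything passes through prime ideals. By Krull's theorem
  (\<open>radical_eq_Inter_primes\<close>), which holds over semirings with the usual maximality proof, the
  radical of an ideal is an intersection of primes; and subtractivity is stable under
  intersections. Since a prime is its own radical, radicals of ideals are subtractive
  exactly when primes are.

  Subtractivity of a prime \<open>P\<close> is what Gauss's lemma needs
  (\<open>subtractive_prime_content_mult\<close>): if \<open>f\<^sub>i\<close> and \<open>g\<^sub>j\<close> are the first coefficients outside \<open>P\<close>,
  then the coefficient of \<open>f g\<close> in degree \<open>i + j\<close> is \<open>f\<^sub>i g\<^sub>j\<close> plus an element of \<open>P\<close>, and in the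
  absence of negatives only subtractivity allows the second summand to be cancelled.
  Together with Krull's theorem this gives the weak Gaussian property.

  Conversely, the weak Gaussian property forces primes to be subtractive because of the
  product
  \<open>(1 + X) (a + b X + a X\<^sup>2) = a + (a + b) X + (a + b) X\<^sup>2 + a X\<^sup>3\<close>:
  its coefficients only involve \<open>a\<close> and \<open>a + b\<close>, while \<open>b\<close> is a product of
  coefficients of the factors.
\<close>

section \<open>Ideals and their radicals\<close>

lemma semiring_ideal_add: "semiring_ideal I \<Longrightarrow> a \<in> I \<Longrightarrow> b \<in> I \<Longrightarrow> a + b \<in> I"
  by (simp add: semiring_ideal_def)

lemma semiring_ideal_mult_left: "semiring_ideal I \<Longrightarrow> a \<in> I \<Longrightarrow> s * a \<in> I"
  by (simp add: semiring_ideal_def)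

lemma semiring_ideal_mult_right: "semiring_ideal I \<Longrightarrow> a \<in> I \<Longrightarrow> a * s \<in> I"
  by (metis mult.commute semiring_ideal_mult_left)

lemma semiring_ideal_zero: "semiring_ideal I \<Longrightarrow> 0 \<in> I"
  by (metis all_not_in_conv mult_zero_left semiring_ideal_def)

lemma semiring_ideal_sum:
  assumes "semiring_ideal I" "\<And>i. i \<in> A \<Longrightarrow> f i \<in> I"
  shows "sum f A \<in> I"
  using assms(2)
  by (induction A rule: infinite_finite_induct)
    (auto intro: semiring_ideal_add semiring_ideal_zero assms(1))

lemma semiring_ideal_hull: "semiring_ideal (semiring_ideal hull A)"
proof -
  have "0 \<in> semiring_ideal hull A"
    by (simp add: hull_def semiring_ideal_zero)
  thus ?thesis
    unfolding semiring_ideal_def hull_def by blast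
qed

lemma semiring_ideal_Union_chain:
  assumes "\<C> \<noteq> {}" "\<And>I. I \<in> \<C> \<Longrightarrow> semiring_ideal I"
    and chain: "\<And>I J. I \<in> \<C> \<Longrightarrow> J \<in> \<C> \<Longrightarrow> I \<subseteq> J \<or> J \<subseteq> I"
  shows "semiring_ideal (\<Union>\<C>)"
  unfolding semiring_ideal_def
proof (intro conjI ballI allI)
  show "\<Union>\<C> \<noteq> {}"
    using assms(1,2) by (auto dest: semiring_ideal_zero)
next
  fix a b assume "a \<in> \<Union>\<C>" "b \<in> \<Union>\<C>"
  then obtain I J where "I \<in> \<C>" "a \<in> I" "J \<in> \<C>" "b \<in> J" by blast
  then obtain K where "K \<in> \<C>" "a \<in> K" "b \<in> K"
    using chain by blast
  thus "a + b \<in> \<Union>\<C>"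
    using assms(2) semiring_ideal_add by blast
next
  fix s a assume "a \<in> \<Union>\<C>"
  thus "s * a \<in> \<Union>\<C>"
    using assms(2) semiring_ideal_mult_left by blast
qed

lemma semiring_ideal_adjoin:
  assumes "semiring_ideal I"
  shows "semiring_ideal {p + r * a |p r. p \<in> I}"
  unfolding semiring_ideal_def
proof (intro conjI ballI allI)
  show "{p + r * a |p r. p \<in> I} \<noteq> {}"
    using semiring_ideal_zero[OF assms] by blast
next
  fix x y assume "x \<in> {p + r * a |p r. p \<in> I}" "y \<in> {p + r * a |p r. p \<in> I}"
  then obtain p r q t where "x = p + r * a" "y = q + t * a" "p \<in> I" "q \<in> I" by blast
  moreover from this have "x + y = (p + q) + (r + t) * a"
    by (simp add: algebra_simps)
  ultimately show "x + y \<in> {p + r * a |p r. p \<in> I}"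
    using semiring_ideal_add[OF assms] by blast
next
  fix s x assume "x \<in> {p + r * a |p r. p \<in> I}"
  then obtain p r where "x = p + r * a" "p \<in> I" by blast
  moreover from this have "s * x = s * p + (s * r) * a"
    by (simp add: algebra_simps)
  ultimately show "s * x \<in> {p + r * a |p r. p \<in> I}"
    using semiring_ideal_mult_left[OF assms] by blast
qed

lemma radical_mono: "I \<subseteq> J \<Longrightarrow> radical I \<subseteq> radical J"
  by (auto simp: radical_def)

lemma prime_semiring_ideal_power:
  assumes "prime_semiring_ideal P" "s ^ n \<in> P" "n > 0"
  shows "s \<in> P"
  using assms(2,3)
proof (induction n)
  case (Suc n)
  show ?case
  proof (cases "n = 0")
    case False
    have "s \<in> P \<or> s ^ n \<in> P"
      using assms(1) Suc.prems(1) by (simp add: prime_semiring_ideal_def)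
    thus ?thesis using Suc.IH False by blast
  qed (use Suc.prems in simp)
qed simp

lemma radical_prime: "prime_semiring_ideal P \<Longrightarrow> radical P = P"
  using prime_semiring_ideal_power by (auto simp: radical_def intro: exI[of _ 1])

section \<open>The radical as an intersection of primes\<close>

text \<open>
  An ideal maximal among those avoiding the powers of \<open>s\<close> is prime: adjoining either of two
  elements \<open>a\<close>, \<open>b\<close> outside it produces a power of \<open>s\<close>, and the product of these
  two powers lies in the ideal as soon as \<open>a * b\<close> does.
\<close>

lemma maximal_avoiding_powers_prime:
  assumes P: "semiring_ideal P" and avoid: "\<And>n. n > 0 \<Longrightarrow> s ^ n \<notin> P"
    and maximal: "\<And>Q. semiring_ideal Q \<Longrightarrow> P \<subseteq> Q \<Longrightarrow> (\<And>n. n > 0 \<Longrightarrow> s ^ n \<notin> Q) \<Longrightarrow> Q = P"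
  shows "prime_semiring_ideal P"
  unfolding prime_semiring_ideal_def
proof (intro conjI allI impI)
  show "semiring_ideal P" by (rule P)
  show "P \<noteq> UNIV" using avoid[of 1] by auto
  have power_in: "\<exists>n>0. \<exists>p r. s ^ n = p + r * a \<and> p \<in> P" if "a \<notin> P" for a
  proof (rule ccontr)
    assume "\<not> ?thesis"
    hence "s ^ n \<notin> {p + r * a |p r. p \<in> P}" if "n > 0" for n
      using that by blast
    moreover have "P \<subseteq> {p + r * a |p r. p \<in> P}"
      by (force intro: exI[of _ 0])
    ultimately have "{p + r * a |p r. p \<in> P} = P"
      using maximal semiring_ideal_adjoin[OF P] by presburger
    moreover have "a \<in> {p + r * a |p r. p \<in> P}"
      using semiring_ideal_zero[OF P] by (metis (mono_tags, lifting) CollectI add_0 mult_1)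
    ultimately show False using that by simp
  qed
  fix a b assume ab: "a * b \<in> P"
  show "a \<in> P \<or> b \<in> P"
  proof (rule ccontr)
    assume "\<not> (a \<in> P \<or> b \<in> P)"
    then obtain n p r m q t where n: "n > 0" "s ^ n = p + r * a" "p \<in> P"
      and m: "s ^ m = q + t * b" "q \<in> P"
      using power_in by meson
    have "s ^ (n + m) = p * (q + t * b) + (r * a * q + r * t * (a * b))"
      by (simp add: power_add n m algebra_simps)
    also have "\<dots> \<in> P"
      using n(3) m(2) ab
      by (meson P semiring_ideal_add semiring_ideal_mult_left semiring_ideal_mult_right)
    finally show False using avoid[of "n + m"] n(1) by simp
  qed
qed

lemma exists_prime_avoiding:
  assumes I: "semiring_ideal I" and s: "s \<notin> radical I"
  shows "\<exists>P. prime_semiring_ideal P \<and> I \<subseteq> P \<and> s \<notin> P"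
proof -
  define \<A> where "\<A> = {J. semiring_ideal J \<and> I \<subseteq> J \<and> (\<forall>n>0. s ^ n \<notin> J)}"
  have "\<exists>P\<in>\<A>. \<forall>Q\<in>\<A>. P \<subseteq> Q \<longrightarrow> Q = P"
  proof (rule subset_Zorn_nonempty)
    show "\<A> \<noteq> {}" using I s by (auto simp: \<A>_def radical_def)
  next
    fix \<C> assume \<C>: "\<C> \<noteq> {}" "subset.chain \<A> \<C>"
    have "semiring_ideal (\<Union>\<C>)"
      using \<C> by (intro semiring_ideal_Union_chain) (auto simp: subset_chain_def \<A>_def)
    thus "\<Union>\<C> \<in> \<A>"
      using \<C> by (auto simp: subset_chain_def \<A>_def)
  qed
  then obtain P where P: "P \<in> \<A>" and maximal: "\<And>Q. Q \<in> \<A> \<Longrightarrow> P \<subseteq> Q \<Longrightarrow> Q = P"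
    by blast
  have "prime_semiring_ideal P"
    using P maximal by (intro maximal_avoiding_powers_prime[of P s]) (auto simp: \<A>_def)
  moreover have "s \<notin> P"
    using P by (auto simp: \<A>_def dest: spec[of _ 1])
  ultimately show ?thesis using P by (auto simp: \<A>_def)
qed

lemma radical_eq_Inter_primes:
  assumes "semiring_ideal I"
  shows "radical I = \<Inter>{P. prime_semiring_ideal P \<and> I \<subseteq> P}"
  using exists_prime_avoiding[OF assms] radical_mono radical_prime by blast

lemma subtractive_Inter: "(\<And>J. J \<in> \<J> \<Longrightarrow> subtractive J) \<Longrightarrow> subtractive (\<Inter>\<J>)"
  unfolding subtractive_def by blast

theorem radicals_subtractive_iff_primes_subtractive:
  "(\<forall>I :: 'a::comm_semiring_1 set. semiring_ideal I \<longrightarrow> subtractive (radical I)) \<longleftrightarrow>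
   (\<forall>P :: 'a set. prime_semiring_ideal P \<longrightarrow> subtractive P)"
proof (intro iffI allI impI)
  fix P :: "'a set"
  assume "\<forall>I :: 'a set. semiring_ideal I \<longrightarrow> subtractive (radical I)" "prime_semiring_ideal P"
  thus "subtractive P" by (metis prime_semiring_ideal_def radical_prime)
next
  fix I :: "'a set"
  assume "\<forall>P :: 'a set. prime_semiring_ideal P \<longrightarrow> subtractive P" "semiring_ideal I"
  thus "subtractive (radical I)"
    by (auto simp: radical_eq_Inter_primes intro: subtractive_Inter)
qed

section \<open>Content ideals and subtractive primes\<close>

lemma semiring_ideal_content_ideal: "semiring_ideal (content_ideal f)"
  by (simp add: content_ideal_def semiring_ideal_hull)

lemma coeff_in_content_ideal: "coeff f n \<in> content_ideal f"
  unfolding content_ideal_def by (rule hull_inc) simp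

lemma content_ideal_subset_iff:
  "semiring_ideal I \<Longrightarrow> content_ideal f \<subseteq> I \<longleftrightarrow> (\<forall>n. coeff f n \<in> I)"
  unfolding content_ideal_def by (subst subset_hull) auto

lemma ideal_prod_memI: "a \<in> I \<Longrightarrow> b \<in> J \<Longrightarrow> a * b \<in> ideal_prod I J"
  unfolding ideal_prod_def mem_Collect_eq
  by (rule exI[of _ 1], rule exI[of _ "\<lambda>_. a"], rule exI[of _ "\<lambda>_. b"]) simp

lemma ideal_prod_subset:
  assumes "semiring_ideal K" "\<And>a b. a \<in> I \<Longrightarrow> b \<in> J \<Longrightarrow> a * b \<in> K"
  shows "ideal_prod I J \<subseteq> K"
  using assms by (auto simp: ideal_prod_def intro!: semiring_ideal_sum)

text \<open>
  The first coefficients outside \<open>P\<close> are compared. In degree \<open>i + j\<close>, every product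
  \<open>f\<^sub>k g\<^sub>l\<close> other than \<open>f\<^sub>i g\<^sub>j\<close> has \<open>k < i\<close> or \<open>l < j\<close>, hence lies in \<open>P\<close>.
\<close>

lemma subtractive_prime_content_mult:
  assumes P: "prime_semiring_ideal P" and sub: "subtractive P"
    and fg: "content_ideal (f * g) \<subseteq> P"
  shows "content_ideal f \<subseteq> P \<or> content_ideal g \<subseteq> P"
proof (rule ccontr)
  assume "\<not> ?thesis"
  have I: "semiring_ideal P" using P by (simp add: prime_semiring_ideal_def)
  from \<open>\<not> ?thesis\<close> have ex: "\<exists>i. coeff f i \<notin> P" "\<exists>j. coeff g j \<notin> P"
    by (auto simp: content_ideal_subset_iff[OF I])
  obtain i where i: "coeff f i \<notin> P" "\<And>k. k < i \<Longrightarrow> coeff f k \<in> P"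
    using exists_least_iff[of "\<lambda>i. coeff f i \<notin> P"] ex(1) by auto
  obtain j where j: "coeff g j \<notin> P" "\<And>k. k < j \<Longrightarrow> coeff g k \<in> P"
    using exists_least_iff[of "\<lambda>i. coeff g i \<notin> P"] ex(2) by auto
  define rest where "rest = (\<Sum>k\<in>{..i + j} - {i}. coeff f k * coeff g (i + j - k))"
  have "rest \<in> P"
    unfolding rest_def
  proof (rule semiring_ideal_sum[OF I])
    fix k assume "k \<in> {..i + j} - {i}"
    hence "k < i \<or> i + j - k < j" by auto
    thus "coeff f k * coeff g (i + j - k) \<in> P"
      using i(2) j(2) semiring_ideal_mult_left[OF I] semiring_ideal_mult_right[OF I] by blast
  qed
  moreover have "coeff (f * g) (i + j) = rest + coeff f i * coeff g j"
    by (simp add: coeff_mult rest_def sum.remove[of "{..i + j}" i] add.commute)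
  moreover have "coeff (f * g) (i + j) \<in> P"
    using fg coeff_in_content_ideal by blast
  ultimately have "coeff f i * coeff g j \<in> P"
    using sub by (auto simp: subtractive_def)
  thus False using P i(1) j(1) by (auto simp: prime_semiring_ideal_def)
qed

lemma weak_Gaussian_if_primes_subtractive:
  assumes "\<And>P :: 'a::comm_semiring_1 set. prime_semiring_ideal P \<Longrightarrow> subtractive P"
  shows "weak_Gaussian TYPE('a)"
proof -
  have "ideal_prod (content_ideal f) (content_ideal g) \<subseteq> P"
    if P: "prime_semiring_ideal P" and fg: "content_ideal (f * g) \<subseteq> P"
    for f g :: "'a poly" and P
  proof -
    have I: "semiring_ideal P" using P by (simp add: prime_semiring_ideal_def)
    show ?thesis
      using subtractive_prime_content_mult[OF P assms[OF P] fg]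
      by (intro ideal_prod_subset I)
        (auto intro: semiring_ideal_mult_left[OF I] semiring_ideal_mult_right[OF I])
  qed
  thus ?thesis
    unfolding weak_Gaussian_def radical_eq_Inter_primes[OF semiring_ideal_content_ideal] by blast
qed

lemma weak_Gaussian_imp_prime_subtractive:
  fixes P :: "'a::comm_semiring_1 set"
  assumes wG: "weak_Gaussian TYPE('a)" and P: "prime_semiring_ideal P"
  shows "subtractive P"
  unfolding subtractive_def
proof (intro allI impI)
  fix a b assume ab: "a + b \<in> P" "a \<in> P"
  have I: "semiring_ideal P" using P by (simp add: prime_semiring_ideal_def)
  \<comment> \<open>The third coefficient \<open>a\<close> of the second factor keeps \<open>b\<close> from being the leading
    coefficient of the product; in the product \<open>b\<close> then occurs only in \<open>a + b\<close>.\<close>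
  let ?f = "[:1, 1:] :: 'a poly" and ?g = "[:a, b, a:]"
  have "?f * ?g = [:a, a + b, a + b, a:]"
    by (simp add: add.commute)
  hence "content_ideal (?f * ?g) \<subseteq> P"
    using ab semiring_ideal_zero[OF I]
    by (auto simp: content_ideal_subset_iff[OF I] coeff_pCons split: nat.split)
  hence "radical (content_ideal (?f * ?g)) \<subseteq> P"
    using radical_mono radical_prime[OF P] by blast
  moreover have "1 * b \<in> ideal_prod (content_ideal ?f) (content_ideal ?g)"
    using coeff_in_content_ideal[of ?f 0] coeff_in_content_ideal[of ?g 1]
    by (intro ideal_prod_memI) auto
  ultimately show "b \<in> P"
    using wG unfolding weak_Gaussian_def by (metis mult_1 subsetD)
qed

theorem theorem19:
  shows "(weak_Gaussian TYPE('a::comm_semiring_1) \<longleftrightarrow>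
            (\<forall>I :: 'a set. semiring_ideal I \<longrightarrow> subtractive (radical I)))
       \<and> ((\<forall>I :: 'a set. semiring_ideal I \<longrightarrow> subtractive (radical I)) \<longleftrightarrow>
            (\<forall>P :: 'a set. prime_semiring_ideal P \<longrightarrow> subtractive P))"
  unfolding radicals_subtractive_iff_primes_subtractive
  using weak_Gaussian_if_primes_subtractive weak_Gaussian_imp_prime_subtractive by blast

end
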